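(* Let $X$ be a Banach space admitting an equivalent norm with property $(\beta)$. Then $\mathrm{c}_0$ is not a uniform subquotient of $X$ via a uniform quotient map that is Lipschitz for large distances; that is, there do not exist a subset $Z\subset X$ and a uniform quotient map $f\colon Z\to\mathrm{c}_0$ that is Lipschitz for large distances.
   Context: All metric spaces are nonempty and $B_M(x,r)$ denotes the closed ball of a metric space $M$. A map $f\colon M\to N$ between metric spaces is a uniform quotient map if there are non-decreasing functions $\rho,\omega\colon[0,\infty)\to[0,\infty)$ with $\lim_{t\to0}\omega(t)=0$ and $\rho(t)>0$ for all $t>0$ such that for all $x\in M$ and $r\in(0,\infty)$, $B_N(f(x),\rho(r))\subset f(B_M(x,r))\subset B_N(f(x),\omega(r))$. $N$ is a uniform subquotient of $M$ if there is a uniform quotient map from a subset of $M$ to $N$. A map $f\colon M\to N$ is Lipschitz for large distances if for every $s\in(0,\infty)$ there is $L\in(0,\infty)$ (depending on $s$) such that $f(B_M(x,r))\subset B_N(f(x),Lr)$ for all $r\ge s$ and $x\in M$. A Banach space $X$ with closed unit ball $B_X$ has property $(\beta)$ if for any $\varepsilon>0$ there is $\delta(\varepsilon)\in(0,1)$ such that for every $x\in B_X$ and every sequence $(y_i)_{i=1}^\infty\subset B_X$ with $\inf\{\|y_n-y_m\|: n\ne m\}\ge\varepsilon$ there is $i_0\in\mathbb N$ with $\left\|\frac{x-y_{i_0}}2\right\|\le 1-\delta(\varepsilon)$. *)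

theory Defs
  imports "HOL-Analysis.Analysis"
begin

(* Metric spaces are carrier sets inside a type of class metric_space, with the restricted
   distance; the closed ball B_M(x,r) is "cball x r \<inter> M". *)

(* All metric spaces are nonempty by convention; without "M \<noteq> {}" the ball condition would hold
   vacuously for the empty domain. Only the values of \<rho> and \<omega> on [0,\<infinity>) matter. *)
definition uniform_quotient_map ::
    "'a::metric_space set \<Rightarrow> 'b::metric_space set \<Rightarrow> ('a \<Rightarrow> 'b) \<Rightarrow> bool" where
  "uniform_quotient_map M N f \<longleftrightarrow>
     M \<noteq> {} \<and> f \<in> M \<rightarrow> N \<and>
     (\<exists>\<rho> \<omega> :: real \<Rightarrow> real.
        \<rho> \<in> {0..} \<rightarrow> {0..} \<and> \<omega> \<in> {0..} \<rightarrow> {0..} \<and>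
        mono_on {0..} \<rho> \<and> mono_on {0..} \<omega> \<and>
        (\<omega> \<longlongrightarrow> 0) (at_right 0) \<and> (\<forall>t>0. \<rho> t > 0) \<and>
        (\<forall>x\<in>M. \<forall>r>0.
           cball (f x) (\<rho> r) \<inter> N \<subseteq> f ` (cball x r \<inter> M) \<and>
           f ` (cball x r \<inter> M) \<subseteq> cball (f x) (\<omega> r) \<inter> N))"

definition lipschitz_large_distances ::
    "'a::metric_space set \<Rightarrow> 'b::metric_space set \<Rightarrow> ('a \<Rightarrow> 'b) \<Rightarrow> bool" where
  "lipschitz_large_distances M N f \<longleftrightarrow>
     (\<forall>s>0. \<exists>L>0. \<forall>r\<ge>s. \<forall>x\<in>M. f ` (cball x r \<inter> M) \<subseteq> cball (f x) (L * r) \<inter> N)"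

definition is_norm :: "('a::real_vector \<Rightarrow> real) \<Rightarrow> bool" where
  "is_norm p \<longleftrightarrow>
     (\<forall>x. 0 \<le> p x) \<and> (\<forall>x. p x = 0 \<longleftrightarrow> x = 0) \<and>
     (\<forall>c x. p (c *\<^sub>R x) = \<bar>c\<bar> * p x) \<and> (\<forall>x y. p (x + y) \<le> p x + p y)"

definition equivalent_norm :: "('a::real_normed_vector \<Rightarrow> real) \<Rightarrow> bool" where
  "equivalent_norm p \<longleftrightarrow>
     is_norm p \<and> (\<exists>a>0. \<exists>b>0. \<forall>x. a * norm x \<le> p x \<and> p x \<le> b * norm x)"

definition property_beta :: "('a::real_vector \<Rightarrow> real) \<Rightarrow> bool" where
  "property_beta p \<longleftrightarrow>
     (\<forall>\<epsilon>>0. \<exists>\<delta>. 0 < \<delta> \<and> \<delta> < 1 \<and>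
        (\<forall>x (y :: nat \<Rightarrow> 'a).
           p x \<le> 1 \<longrightarrow> (\<forall>i. p (y i) \<le> 1) \<longrightarrow>
           Inf {p (y n - y m) | n m. n \<noteq> m} \<ge> \<epsilon> \<longrightarrow>
           (\<exists>i. p ((1/2) *\<^sub>R (x - y i)) \<le> 1 - \<delta>)))"

(* Since nat is discrete, "nat \<Rightarrow>\<^sub>C real" is the space of all bounded real sequences
   with the supremum norm; c0 carries the restricted norm. *)
definition c0 :: "(nat \<Rightarrow>\<^sub>C real) set" where
  "c0 = {x. apply_bcontfun x \<longlonglongrightarrow> 0}"

end

theory Submission
  imports Defs
begin

text \<open>
  The proof is a self-improvement argument for the rate at which \<open>f\<close> lifts points.  Say that
  \<open>f\<close> is co-Lipschitz with constant \<open>c\<close> from scale \<open>d\<close> on if every target point within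
  \<open>c r\<close> of \<open>f z\<close> has a preimage within \<open>r\<close> of \<open>z\<close>, for all \<open>r \<ge> d\<close>.  Three facts are
  incompatible.

  \<^item> Some positive constant occurs: segments in \<open>c\<^sub>0\<close> can be cut into steps of length \<open>\<rho> 1\<close>, each of
    which \<open>f\<close> lifts to a step of length \<open>1\<close> (\<open>uniform_quotient_imp_co_lipschitz\<close>).

  \<^item> Constants are bounded by the Lipschitz constant of \<open>f\<close> at large distances
    (\<open>co_lipschitz_constant_le\<close>).

  \<^item> If \<open>c\<close> occurs, so does \<open>\<theta> c\<close>, for a fixed \<open>\<theta> > 1\<close> (\<open>co_lipschitz_improvement\<close>).

  The last fact is where the two geometries clash.  Split a segment from \<open>f z\<close> to \<open>w\<close> in \<open>c\<^sub>0\<close> into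
  three equal parts of length at most \<open>R\<close>.  Adding \<open>R/2\<close> times a unit vector far out to the
  second division point keeps it within \<open>R\<close> of the first division point and of \<open>w\<close>, since the norm is a maximum;
  this gives infinitely many separated points to pass through (\<open>c0_fork\<close>).  Lifting the first
  division point and then all these points produces a fork in \<open>X\<close>: a centre \<open>x\<close>, a handle \<open>z\<close> and
  prongs \<open>y\<^sub>n\<close>, all prongs and the handle within \<open>s = R/c\<close> of \<open>x\<close>, and the prongs are separated
  because \<open>f\<close> is Lipschitz for large distances.  Property \<open>(\<beta>)\<close> then makes one prong closer to
  the handle than \<open>2 s\<close> by a fixed proportion, and so the lift of the whole path through this
  prong is shorter than \<open>3 s\<close> by a fixed proportion.
\<close>

section \<open>Forks under property beta\<close>

lemma is_norm_minus_commute: "is_norm p \<Longrightarrow> p (x - y) = p (y - x)"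
  unfolding is_norm_def
  by (metis abs_1 abs_minus_cancel minus_diff_eq mult_1 scaleR_minus1_left)

lemma is_norm_triangle_diff: "is_norm p \<Longrightarrow> p (x - z) \<le> p (x - y) + p (y - z)"
  unfolding is_norm_def by (metis add_diff_eq diff_add_cancel)

lemma is_norm_scaleR: "is_norm p \<Longrightarrow> p (c *\<^sub>R x) = \<bar>c\<bar> * p x"
  unfolding is_norm_def by blast

text \<open>Property \<open>(\<beta>)\<close> moved to an arbitrary centre \<open>x\<close> and scale \<open>s\<close>.\<close>

lemma property_beta_fork:
  fixes p :: "'a::real_vector \<Rightarrow> real"
  assumes p: "is_norm p" and beta: "property_beta p" and eps: "\<epsilon> > 0"
  obtains \<delta> where "0 < \<delta>" "\<delta> < 1"
    "\<And>s x z (y :: nat \<Rightarrow> 'a). \<lbrakk>s > 0; p (z - x) \<le> s; \<And>n. p (y n - x) \<le> s;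
        \<And>n m. n \<noteq> m \<Longrightarrow> p (y n - y m) \<ge> \<epsilon> * s\<rbrakk> \<Longrightarrow> \<exists>i. p (y i - z) \<le> 2 * (1 - \<delta>) * s"
proof -
  from beta[unfolded property_beta_def, THEN spec, THEN mp, OF eps]
  obtain \<delta> where \<delta>: "0 < \<delta>" "\<delta> < 1"
    and B: "\<forall>x (y :: nat \<Rightarrow> 'a). p x \<le> 1 \<longrightarrow> (\<forall>i. p (y i) \<le> 1) \<longrightarrow>
      Inf {p (y n - y m) | n m. n \<noteq> m} \<ge> \<epsilon> \<longrightarrow> (\<exists>i. p ((1/2) *\<^sub>R (x - y i)) \<le> 1 - \<delta>)"
    by (elim exE conjE)
  have "\<exists>i. p (y i - z) \<le> 2 * (1 - \<delta>) * s"
    if s: "s > 0" and z: "p (z - x) \<le> s" and y: "\<And>n. p (y n - x) \<le> s"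
      and sep: "\<And>n m. n \<noteq> m \<Longrightarrow> p (y n - y m) \<ge> \<epsilon> * s"
    for s x z and y :: "nat \<Rightarrow> 'a"
  proof -
    define z' where "z' = (1/s) *\<^sub>R (z - x)"
    define y' where "y' n = (1/s) *\<^sub>R (y n - x)" for n
    have diff: "y' n - y' m = (1/s) *\<^sub>R (y n - y m)" for n m
      by (simp add: y'_def scaleR_diff_right)
    have "p z' \<le> 1" "p (y' n) \<le> 1" for n
      using z y[of n] s by (simp_all add: z'_def y'_def is_norm_scaleR[OF p])
    moreover have "Inf {p (y' n - y' m) | n m. n \<noteq> m} \<ge> \<epsilon>"
    proof (rule cInf_greatest)
      show "{p (y' n - y' m) | n m. n \<noteq> m} \<noteq> {}"
        using zero_neq_one by blast
    next
      fix t assume "t \<in> {p (y' n - y' m) | n m. n \<noteq> m}"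
      then obtain n m where "n \<noteq> m" and t: "t = p (y' n - y' m)" by blast
      have "t = p (y n - y m) / s"
        using s by (simp add: t diff is_norm_scaleR[OF p])
      with sep[OF \<open>n \<noteq> m\<close>] s show "\<epsilon> \<le> t"
        by (simp add: pos_le_divide_eq)
    qed
    ultimately obtain i where i: "p ((1/2) *\<^sub>R (z' - y' i)) \<le> 1 - \<delta>"
      using B[THEN spec[of _ z'], THEN spec[of _ y']] by blast
    have eq: "(1/2) *\<^sub>R (z' - y' i) = (1 / (2 * s)) *\<^sub>R (z - y i)"
      by (simp add: z'_def y'_def flip: scaleR_diff_right)
    have "p ((1/2) *\<^sub>R (z' - y' i)) = p (z - y i) / (2 * s)"
      unfolding eq is_norm_scaleR[OF p] using s by simp
    with i have "p (z - y i) \<le> 2 * (1 - \<delta>) * s"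
      using s by (simp add: pos_divide_le_eq mult_ac)
    then show ?thesis
      using is_norm_minus_commute[OF p] by metis
  qed
  with \<delta> that show thesis by blast
qed

section \<open>Forks in the space of null sequences\<close>

lemma subspace_c0: "subspace c0"
proof (rule subspaceI)
  show "0 \<in> c0"
    by (simp add: c0_def)
  show "x + y \<in> c0" if "x \<in> c0" "y \<in> c0" for x y
    using that tendsto_add[of x 0 sequentially y 0] by (simp add: c0_def)
  show "c *\<^sub>R x \<in> c0" if "x \<in> c0" for c x
    using that tendsto_mult_left[of x 0 sequentially c] by (simp add: c0_def)
qed

definition unit_seq :: "nat \<Rightarrow> nat \<Rightarrow>\<^sub>C real" where
  "unit_seq n = Bcontfun (\<lambda>k. of_bool (k = n))"

lemma unit_seq_apply [simp]: "apply_bcontfun (unit_seq n) k = of_bool (k = n)"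
proof -
  have "(\<lambda>k. of_bool (k = n) :: real) \<in> bcontfun"
    by (intro bcontfun_normI[where b = 1]) auto
  then show ?thesis
    by (simp add: unit_seq_def Bcontfun_inverse)
qed

lemma unit_seq_in_c0: "unit_seq n \<in> c0"
proof -
  have "eventually (\<lambda>k. of_bool (k = n) = (0::real)) sequentially"
    using eventually_gt_at_top[of n] by eventually_elim auto
  then show ?thesis
    by (simp add: c0_def tendsto_eventually)
qed

lemma norm_unit_seq: "norm (unit_seq n) = 1"
proof (rule antisym)
  show "norm (unit_seq n) \<le> 1" by (rule norm_bound) auto
  show "1 \<le> norm (unit_seq n)" using norm_bounded[of "unit_seq n" n] by simp
qed

text \<open>
  The \<open>u n\<close> are perturbed copies of the point two thirds along the segment from \<open>0\<close> to \<open>h\<close>.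
  Only coordinates where \<open>h\<close> is small are perturbed, and so the distances to \<open>h/3\<close> and \<open>h\<close> do not
  exceed \<open>R\<close>, exactly as for the unperturbed point.
\<close>

lemma c0_fork:
  assumes h: "h \<in> c0" "norm h \<le> 3 * R" and R: "R > 0"
  obtains u :: "nat \<Rightarrow> nat \<Rightarrow>\<^sub>C real" where
    "\<And>n. u n \<in> c0" "\<And>n. norm (u n - (1/3) *\<^sub>R h) \<le> R" "\<And>n. norm (h - u n) \<le> R"
    "\<And>n m. n \<noteq> m \<Longrightarrow> norm (u n - u m) \<ge> R / 2"
proof -
  have "h \<longlonglongrightarrow> 0" using h by (simp add: c0_def)
  then have "eventually (\<lambda>n. \<bar>h n\<bar> < R) sequentially"
    using R tendstoD[of h 0 sequentially R] by simp
  then obtain N where N: "\<And>n. n \<ge> N \<Longrightarrow> \<bar>h n\<bar> < R"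
    by (auto simp: eventually_sequentially)
  have hk: "\<bar>h k\<bar> \<le> 3 * R" for k
    using norm_bounded[of h k] h(2) by simp
  define u where "u n = (2/3) *\<^sub>R h + (R/2) *\<^sub>R unit_seq (N + n)" for n
  have u_apply: "u n k = 2/3 * h k + R/2 * of_bool (k = N + n)" for n k
    by (simp add: u_def)
  show thesis
  proof
    show "u n \<in> c0" for n
      unfolding u_def by (intro subspace_add[OF subspace_c0] subspace_scale[OF subspace_c0]
          unit_seq_in_c0 h)
    show "norm (u n - (1/3) *\<^sub>R h) \<le> R" for n
    proof (rule norm_bound)
      show "norm (apply_bcontfun (u n - (1/3) *\<^sub>R h) k) \<le> R" for k
        using hk[of k] N[of k] R
        by (cases "k = N + n")
          (auto simp: u_apply abs_if split: if_splits)
    qed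
    show "norm (h - u n) \<le> R" for n
    proof (rule norm_bound)
      show "norm (apply_bcontfun (h - u n) k) \<le> R" for k
        using hk[of k] N[of k] R
        by (cases "k = N + n")
          (auto simp: u_apply abs_if split: if_splits)
    qed
    show "norm (u n - u m) \<ge> R / 2" if "n \<noteq> m" for n m
      using norm_bounded[of "u n - u m" "N + n"] that R
      by (simp add: u_apply)
  qed
qed

section \<open>Co-Lipschitz constants at large scales\<close>

definition co_lipschitz_from ::
    "('a::real_vector \<Rightarrow> real) \<Rightarrow> 'a set \<Rightarrow> 'b::real_normed_vector set \<Rightarrow> ('a \<Rightarrow> 'b)
      \<Rightarrow> real \<Rightarrow> real \<Rightarrow> bool" where
  "co_lipschitz_from p Z N f c d \<longleftrightarrow>
     (\<forall>z\<in>Z. \<forall>r\<ge>d. \<forall>w\<in>N. norm (w - f z) \<le> c * r \<longrightarrow> (\<exists>x\<in>Z. f x = w \<and> p (x - z) \<le> r))"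

lemma co_lipschitz_fromE:
  assumes "co_lipschitz_from p Z N f c d" "z \<in> Z" "r \<ge> d" "w \<in> N" "norm (w - f z) \<le> c * r"
  obtains x where "x \<in> Z" "f x = w" "p (x - z) \<le> r"
  using assms unfolding co_lipschitz_from_def by blast

text \<open>
  The radius \<open>1\<close> is an arbitrary choice of step length; the co-uniformity function \<open>\<rho>\<close> enters only
  through \<open>\<rho> 1\<close>.  The target must contain the segments along which the steps are taken.
\<close>

lemma uniform_quotient_imp_co_lipschitz:
  fixes f :: "'a::real_normed_vector \<Rightarrow> 'b::real_normed_vector"
  assumes f: "uniform_quotient_map Z N f" and N: "subspace N"
    and b: "b > 0" "\<And>x. p x \<le> b * norm x"
  obtains c d where "c > 0" "co_lipschitz_from p Z N f c d"
proof -
  have fZ: "f \<in> Z \<rightarrow> N"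
    using f unfolding uniform_quotient_map_def by (elim conjE)
  obtain \<rho> \<omega> :: "real \<Rightarrow> real" where \<rho>: "\<forall>t>0. \<rho> t > 0"
    and balls: "\<forall>x\<in>Z. \<forall>r>0. cball (f x) (\<rho> r) \<inter> N \<subseteq> f ` (cball x r \<inter> Z) \<and>
      f ` (cball x r \<inter> Z) \<subseteq> cball (f x) (\<omega> r) \<inter> N"
    using f unfolding uniform_quotient_map_def by (elim conjE exE)
  define a where "a = \<rho> 1"
  have a: "a > 0" using \<rho> by (simp add: a_def)
  have one_step: "\<exists>x\<in>Z. f x = w \<and> norm (x - z) \<le> 1"
    if "z \<in> Z" "w \<in> N" "norm (w - f z) \<le> a" for z w
  proof -
    have "w \<in> cball (f z) (\<rho> 1) \<inter> N"
      using that by (simp add: a_def dist_norm norm_minus_commute)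
    then have "w \<in> f ` (cball z 1 \<inter> Z)" using balls that(1) zero_less_one by blast
    then show ?thesis by (auto simp: dist_norm norm_minus_commute)
  qed
  have steps: "\<exists>x\<in>Z. f x = w \<and> norm (x - z) \<le> real n"
    if "z \<in> Z" "w \<in> N" "norm (w - f z) \<le> a * real n" for z w n
    using that
  proof (induction n arbitrary: w)
    case 0
    then show ?case by (intro bexI[of _ z]) auto
  next
    case (Suc n)
    define v where "v = f z + (real n / real (Suc n)) *\<^sub>R (w - f z)"
    have fz: "f z \<in> N" using fZ Suc.prems by auto
    have v: "v \<in> N"
      unfolding v_def
      by (intro subspace_add[OF N] subspace_scale[OF N] subspace_diff[OF N] fz Suc.prems)
    have "norm (v - f z) = real n / real (Suc n) * norm (w - f z)"
      by (simp add: v_def)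
    also have "\<dots> \<le> real n / real (Suc n) * (a * real (Suc n))"
      by (intro mult_left_mono Suc.prems) simp
    also have "\<dots> = a * real n" by (simp add: field_simps del: of_nat_Suc)
    finally obtain x where x: "x \<in> Z" "f x = v" "norm (x - z) \<le> real n"
      using Suc.IH[OF Suc.prems(1) v] by blast
    have "w - v = (1 - real n / real (Suc n)) *\<^sub>R (w - f z)"
      by (simp add: v_def scaleR_left_diff_distrib)
    also have "1 - real n / real (Suc n) = 1 / real (Suc n)"
      by (simp add: field_simps)
    finally have "norm (w - v) = norm (w - f z) / real (Suc n)"
      by (simp del: of_nat_Suc)
    then have "norm (w - f x) \<le> a"
      using Suc.prems(3) x(2) by (simp add: pos_divide_le_eq del: of_nat_Suc)
    then obtain x' where x': "x' \<in> Z" "f x' = w" "norm (x' - x) \<le> 1"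
      using one_step x(1) Suc.prems(2) by blast
    have "norm (x' - z) \<le> norm (x' - x) + norm (x - z)"
      using norm_triangle_ineq[of "x' - x" "x - z"] by simp
    then show ?case using x x' by (intro bexI[of _ x']) auto
  qed
  have "co_lipschitz_from p Z N f (a / (2 * b)) b"
    unfolding co_lipschitz_from_def
  proof (intro ballI allI impI)
    fix z r w
    assume z: "z \<in> Z" and r: "b \<le> r" and w: "w \<in> N" and wz: "norm (w - f z) \<le> a / (2 * b) * r"
    (* rounding r/b >= 1 down to an integer loses at most a factor of 2 *)
    define n where "n = nat \<lfloor>r / b\<rfloor>"
    have ge1: "r / b \<ge> 1" using r b by simp
    then have n_real: "real n = of_int \<lfloor>r / b\<rfloor>" by (simp add: n_def)
    have "\<lfloor>r / b\<rfloor> \<ge> 1" using ge1 by simp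
    then have n: "real n \<le> r / b" "r / b \<le> 2 * real n"
      unfolding n_real by linarith+
    have "a / (2 * b) * r = a / 2 * (r / b)" by simp
    also have "\<dots> \<le> a / 2 * (2 * real n)"
      using n a by (intro mult_left_mono) auto
    finally have "norm (w - f z) \<le> a * real n" using wz by simp
    from steps[OF z w this] obtain x where x: "x \<in> Z" "f x = w" "norm (x - z) \<le> real n"
      by blast
    have "p (x - z) \<le> b * (r / b)"
      using x(3) n(1) b by (intro order.trans[OF b(2)] mult_left_mono) auto
    then show "\<exists>x\<in>Z. f x = w \<and> p (x - z) \<le> r"
      using x b by (intro bexI[of _ x]) auto
  qed
  with a b that[of "a / (2 * b)" b] show thesis by simp
qed

text \<open>
  The hypothesis \<open>1 \<le> \<epsilon> * d\<close> puts the separation \<open>\<epsilon> s\<close> of the prongs into the range in which \<open>f\<close>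
  is \<open>K\<close>-Lipschitz, while \<open>4 * K * \<epsilon> \<le> c\<close> makes \<open>\<epsilon>\<close> small enough for that separation to be forced.
  Both persist when \<open>c\<close> and \<open>d\<close> grow, so one \<open>\<epsilon>\<close>, and hence one \<open>\<delta>\<close>, serves every round of improvement.
\<close>

lemma co_lipschitz_improvement:
  fixes f :: "'a::real_vector \<Rightarrow> nat \<Rightarrow>\<^sub>C real"
  assumes p: "is_norm p" and fZ: "f \<in> Z \<rightarrow> c0"
    and lip: "\<And>x y r. \<lbrakk>x \<in> Z; y \<in> Z; r \<ge> 1; p (x - y) \<le> r\<rbrakk> \<Longrightarrow> norm (f x - f y) \<le> K * r"
    and \<delta>: "0 < \<delta>" "\<delta> < 1"
    and fork: "\<And>s x z (y :: nat \<Rightarrow> 'a). \<lbrakk>s > 0; p (z - x) \<le> s; \<And>n. p (y n - x) \<le> s;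
        \<And>n m. n \<noteq> m \<Longrightarrow> p (y n - y m) \<ge> \<epsilon> * s\<rbrakk> \<Longrightarrow> \<exists>i. p (y i - z) \<le> 2 * (1 - \<delta>) * s"
    and \<epsilon>: "\<epsilon> > 0" "4 * K * \<epsilon> \<le> c" and c: "c > 0" and d: "d > 0" "1 \<le> \<epsilon> * d"
    and co: "co_lipschitz_from p Z c0 f c d"
  shows "co_lipschitz_from p Z c0 f (c / (1 - 2 * \<delta> / 3)) (3 * d)"
  unfolding co_lipschitz_from_def
proof (intro ballI allI impI)
  fix z r w
  assume z: "z \<in> Z" and r: "3 * d \<le> r" and w: "w \<in> c0"
    and wz: "norm (w - f z) \<le> c / (1 - 2 * \<delta> / 3) * r"
  (* s is the scale of the fork: the lifted path has length at most 2 (1 - delta) s up to a prong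
     and s beyond it, which must add up to r *)
  define s where "s = r / (3 - 2 * \<delta>)"
  define R where "R = c * s"
  have pos: "3 - 2 * \<delta> > 0" using \<delta> by simp
  have sr: "(3 - 2 * \<delta>) * s = r" using pos by (simp add: s_def)
  have "3 * d \<le> 3 * s"
  proof -
    have r0: "r > 0" using r d by simp
    then have "s > 0" using pos by (simp add: s_def)
    then have "\<delta> * s > 0" using \<delta> by simp
    then show ?thesis using sr r by (simp add: algebra_simps)
  qed
  then have ds: "d \<le> s" by simp
  have s: "s > 0" using ds d by simp
  have R: "R > 0" using c s by (simp add: R_def)
  define h where "h = w - f z"
  have fz: "f z \<in> c0" using fZ z by auto
  have h: "h \<in> c0" using w fz subspace_diff[OF subspace_c0] by (simp add: h_def)
  have "c / (1 - 2 * \<delta> / 3) * r = 3 * R"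
    using pos by (simp add: R_def s_def field_simps)
  with wz have hR: "norm h \<le> 3 * R" by (simp add: h_def)
  obtain u :: "nat \<Rightarrow> nat \<Rightarrow>\<^sub>C real" where u: "\<And>n. u n \<in> c0"
      "\<And>n. norm (u n - (1/3) *\<^sub>R h) \<le> R" "\<And>n. norm (h - u n) \<le> R"
      "\<And>n m. n \<noteq> m \<Longrightarrow> norm (u n - u m) \<ge> R / 2"
    using c0_fork[OF h hR R] by blast
  have v: "f z + (1/3) *\<^sub>R h \<in> c0"
    by (intro subspace_add[OF subspace_c0] subspace_scale[OF subspace_c0] fz h)
  have "norm (f z + (1/3) *\<^sub>R h - f z) \<le> c * s"
    using hR by (simp add: R_def)
  from co_lipschitz_fromE[OF co z ds v this] obtain x
    where x: "x \<in> Z" "f x = f z + (1/3) *\<^sub>R h" "p (x - z) \<le> s" by blast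
  have "\<exists>y\<in>Z. f y = f z + u n \<and> p (y - x) \<le> s" for n
  proof -
    have "f z + u n \<in> c0" by (intro subspace_add[OF subspace_c0] fz u)
    moreover have "norm (f z + u n - f x) \<le> c * s"
      using u(2)[of n] by (simp add: x(2) R_def)
    ultimately show ?thesis
      using co x(1) ds unfolding co_lipschitz_from_def by blast
  qed
  then obtain y where y: "\<And>n. y n \<in> Z" "\<And>n. f (y n) = f z + u n" "\<And>n. p (y n - x) \<le> s"
    by metis
  have sep: "p (y n - y m) \<ge> \<epsilon> * s" if "n \<noteq> m" for n m
  proof (rule ccontr)
    assume "\<not> ?thesis"
    then have "p (y n - y m) \<le> \<epsilon> * s" by simp
    moreover have "1 \<le> \<epsilon> * s" using d ds \<epsilon> by (smt (verit) mult_left_mono)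
    ultimately have "norm (f (y n) - f (y m)) \<le> K * (\<epsilon> * s)"
      using lip y(1) by blast
    then have "R / 2 \<le> K * \<epsilon> * s"
      using u(4)[OF that] by (simp add: y(2))
    moreover have "4 * K * \<epsilon> * s \<le> c * s" using \<epsilon> s by (intro mult_right_mono) auto
    ultimately show False using R by (simp add: R_def)
  qed
  have "p (z - x) \<le> s" using x(3) is_norm_minus_commute[OF p] by metis
  then have "\<exists>i. p (y i - z) \<le> 2 * (1 - \<delta>) * s"
    by (rule fork[OF s _ y(3) sep])
  then obtain i where i: "p (y i - z) \<le> 2 * (1 - \<delta>) * s" by blast
  have "norm (w - f (y i)) \<le> c * s"
    using u(3)[of i] by (simp add: y(2) h_def R_def algebra_simps)
  from co_lipschitz_fromE[OF co y(1) ds w this] obtain x'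
    where x': "x' \<in> Z" "f x' = w" "p (x' - y i) \<le> s" by blast
  have "p (x' - z) \<le> p (x' - y i) + p (y i - z)" by (rule is_norm_triangle_diff[OF p])
  also have "\<dots> \<le> s + 2 * (1 - \<delta>) * s" using i x' by simp
  also have "\<dots> = r" using sr by (simp add: algebra_simps)
  finally show "\<exists>x\<in>Z. f x = w \<and> p (x - z) \<le> r" using x' by blast
qed

lemma co_lipschitz_constant_le:
  fixes f :: "'a::real_vector \<Rightarrow> nat \<Rightarrow>\<^sub>C real"
  assumes z: "z \<in> Z" and fZ: "f \<in> Z \<rightarrow> c0" and c: "c > 0"
    and lip: "\<And>x y r. \<lbrakk>x \<in> Z; y \<in> Z; r \<ge> 1; p (x - y) \<le> r\<rbrakk> \<Longrightarrow> norm (f x - f y) \<le> K * r"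
    and co: "co_lipschitz_from p Z c0 f c d"
  shows "c \<le> K"
proof -
  define r where "r = max d 1"
  have r: "r \<ge> d" "r \<ge> 1" by (auto simp: r_def)
  define w where "w = f z + (c * r) *\<^sub>R unit_seq 0"
  have "f z \<in> c0" using fZ z by auto
  then have w: "w \<in> c0"
    unfolding w_def
    by (intro subspace_add[OF subspace_c0] subspace_scale[OF subspace_c0] unit_seq_in_c0)
  have nw: "norm (w - f z) = c * r" using c r by (simp add: w_def norm_unit_seq)
  obtain x where "x \<in> Z" "f x = w" "p (x - z) \<le> r"
    using co_lipschitz_fromE[OF co z r(1) w] nw by auto
  with lip[of x z r] z r nw have "c * r \<le> K * r" by simp
  with r show ?thesis by simp
qed

section \<open>Null sequences and property beta\<close>

theorem theorem4p7:
  assumes "\<exists>p :: 'a::banach \<Rightarrow> real. equivalent_norm p \<and> property_beta p"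
  shows "\<not> (\<exists>(Z :: 'a set) (f :: 'a \<Rightarrow> (nat \<Rightarrow>\<^sub>C real)).
           uniform_quotient_map Z c0 f \<and> lipschitz_large_distances Z c0 f)"
proof
  assume "\<exists>(Z :: 'a set) (f :: 'a \<Rightarrow> (nat \<Rightarrow>\<^sub>C real)).
           uniform_quotient_map Z c0 f \<and> lipschitz_large_distances Z c0 f"
  then obtain Z and f :: "'a \<Rightarrow> (nat \<Rightarrow>\<^sub>C real)"
    where uq: "uniform_quotient_map Z c0 f" and large: "lipschitz_large_distances Z c0 f"
    by blast
  obtain p :: "'a \<Rightarrow> real" where eq: "equivalent_norm p" and beta: "property_beta p"
    using assms by blast
  obtain a b where p: "is_norm p" and a: "a > 0" "\<And>x. a * norm x \<le> p x"
    and b: "b > 0" "\<And>x. p x \<le> b * norm x"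
    using eq unfolding equivalent_norm_def by blast
  obtain z where z: "z \<in> Z" and fZ: "f \<in> Z \<rightarrow> c0"
    using uq unfolding uniform_quotient_map_def by blast

  have "1 / a > 0" using a by simp
  with large obtain L where L: "L > 0"
    and Lip: "\<forall>r\<ge>1/a. \<forall>x\<in>Z. f ` (cball x r \<inter> Z) \<subseteq> cball (f x) (L * r) \<inter> c0"
    unfolding lipschitz_large_distances_def by meson
  define K where "K = L / a"
  have K: "K > 0" using L a by (simp add: K_def)
  have lip: "norm (f x - f y) \<le> K * r"
    if xy: "x \<in> Z" "y \<in> Z" and r: "r \<ge> 1" "p (x - y) \<le> r" for x y r
  proof -
    have "norm (x - y) \<le> r / a"
      using order.trans[OF a(2) r(2)] a(1) by (simp add: field_simps)
    then have "y \<in> cball x (r / a) \<inter> Z" using xy by (simp add: dist_norm)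
    moreover have "1 / a \<le> r / a" using r a by (simp add: divide_right_mono)
    ultimately have "f y \<in> cball (f x) (L * (r / a))" using Lip xy(1) by blast
    then show ?thesis by (simp add: dist_norm K_def)
  qed

  obtain c d where c: "c > 0" and co: "co_lipschitz_from p Z c0 f c d"
    using uniform_quotient_imp_co_lipschitz[OF uq subspace_c0 b] by blast
  define \<epsilon> where "\<epsilon> = c / (4 * K)"
  have \<epsilon>: "\<epsilon> > 0" "4 * K * \<epsilon> = c" using c K by (simp_all add: \<epsilon>_def)
  obtain \<delta> where \<delta>: "0 < \<delta>" "\<delta> < 1"
    and fork: "\<And>s x z (y :: nat \<Rightarrow> 'a). \<lbrakk>s > 0; p (z - x) \<le> s; \<And>n. p (y n - x) \<le> s;
        \<And>n m. n \<noteq> m \<Longrightarrow> p (y n - y m) \<ge> \<epsilon> * s\<rbrakk> \<Longrightarrow> \<exists>i. p (y i - z) \<le> 2 * (1 - \<delta>) * s"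
    using property_beta_fork[OF p beta \<epsilon>(1)] by blast
  define \<theta> where "\<theta> = 1 / (1 - 2 * \<delta> / 3)"
  have \<theta>: "\<theta> > 1" using \<delta> by (simp add: \<theta>_def field_simps)

  have iterate: "\<exists>d. d > 0 \<and> 1 \<le> \<epsilon> * d \<and> co_lipschitz_from p Z c0 f (c * \<theta> ^ n) d" for n
  proof (induction n)
    case 0
    define d' where "d' = max d (1 / \<epsilon>)"
    have "d' \<ge> 1 / \<epsilon>" by (simp add: d'_def)
    then have "1 \<le> \<epsilon> * d'" using \<epsilon>(1) by (simp add: field_simps)
    moreover have "d' > 0" using \<epsilon>(1) by (simp add: d'_def less_max_iff_disj)
    moreover have "co_lipschitz_from p Z c0 f c d'"
      using co unfolding co_lipschitz_from_def d'_def by simp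
    ultimately show ?case by auto
  next
    case (Suc n)
    then obtain e where e: "e > 0" "1 \<le> \<epsilon> * e" "co_lipschitz_from p Z c0 f (c * \<theta> ^ n) e"
      by blast
    have "c * 1 \<le> c * \<theta> ^ n" using c \<theta> by (intro mult_left_mono one_le_power) auto
    then have "4 * K * \<epsilon> \<le> c * \<theta> ^ n" "c * \<theta> ^ n > 0" using \<epsilon> c by auto
    from co_lipschitz_improvement[OF p fZ lip \<delta> fork \<epsilon>(1) this e]
    have "co_lipschitz_from p Z c0 f (c * \<theta> ^ Suc n) (3 * e)"
      by (simp add: \<theta>_def mult.commute)
    moreover have "1 \<le> \<epsilon> * (3 * e)" using e by simp
    ultimately show ?case using e by (intro exI[of _ "3 * e"]) simp
  qed
  obtain n where "K / c < \<theta> ^ n" using real_arch_pow[OF \<theta>] by blast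
  then have n: "K < c * \<theta> ^ n" using c by (simp add: field_simps)
  obtain e where "co_lipschitz_from p Z c0 f (c * \<theta> ^ n) e" using iterate by blast
  moreover have "c * \<theta> ^ n > 0" using n K by simp
  ultimately have "c * \<theta> ^ n \<le> K"
    using co_lipschitz_constant_le[OF z fZ _ lip] by blast
  with n show False by simp
qed

end
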